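(* Let $K$ be a field, $S=K[x_1,\dots,x_n]$, $d\ge 2$, $\mathbf t=(t_1,\dots,t_{d-1})\in\mathbb Z_{\ge 0}^{d-1}$ and $1\le\ell\le d$. Let $L\subset M_{n,\ell,\mathbf t}$ be a $\mathbf t$-spread lex set and let $N\subset M_{n,\ell,\mathbf t}$ be a $\mathbf t$-spread strongly stable set. Suppose $|L|\le|N|$. Then $m_{\le i}(L)\le m_{\le i}(N)$ for all $i\in\{1,\dots,n\}$.
   Context: A monomial $u=x_{j_1}\cdots x_{j_\ell}$ of $S$ with $1\le j_1\le\cdots\le j_\ell\le n$ and degree $\ell\le d$ is $\mathbf t$-spread if $j_{i+1}-j_i\ge t_i$ for $i=1,\dots,\ell-1$. $M_{n,\ell,\mathbf t}$ is the set of all $\mathbf t$-spread monomials of degree $\ell$ in $S$. A set $L\subseteq M_{n,\ell,\mathbf t}$ is a $\mathbf t$-spread strongly stable set if for all $u\in L$ and all $j<i$ such that $x_i$ divides $u$ and $x_j(u/x_i)$ is $\mathbf t$-spread, one has $x_j(u/x_i)\in L$. It is a $\mathbf t$-spread lex set if for all $u\in L$ and $v\in M_{n,\ell,\mathbf t}$ with $v\ge_{\mathrm{lex}}u$ one has $v\in L$, where $\ge_{\mathrm{lex}}$ is the lexicographic order induced by $x_1>\dots>x_n$. The empty set is both. The symbol $\subset$ allows equality. For a monomial $u\neq 1$, $\max(u)=\max\{i: x_i\text{ divides }u\}$. For a set $L\subseteq M_{n,\ell,\mathbf t}$, $m_i(L)$ is the number of $u\in L$ with $\max(u)=i$, and $m_{\le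 j}(L)=\sum_{i=1}^{j}m_i(L)$. *)

theory Defs
  imports "HOL-Library.Poly_Mapping"
begin

text \<open>
  Polynomials over \<open>'k\<close> in the variables \<open>x\<^sub>0, x\<^sub>1, \<dots>\<close>, as finitely supported functions
  from exponent vectors to coefficients. The ring \<open>K[x\<^sub>1,\<dots>,x\<^sub>n]\<close> is the subring of the
  polynomials in which only \<open>x\<^sub>1, \<dots>, x\<^sub>n\<close> occur.
\<close>

type_synonym 'k mpoly = "(nat \<Rightarrow>\<^sub>0 nat) \<Rightarrow>\<^sub>0 'k"

definition monom :: "(nat \<Rightarrow>\<^sub>0 nat) \<Rightarrow> 'k::field mpoly" where
  "monom a = Poly_Mapping.single a 1"

definition X :: "nat \<Rightarrow> 'k::field mpoly" where
  "X i = monom (Poly_Mapping.single i 1)"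

text \<open>
  Lists are indexed from 0, so \<open>t ! i\<close> is $t_{i+1}$ and \<open>js ! i\<close> is $j_{i+1}$. The number
  $d$ is \<open>length t + 1\<close>, and a monomial of degree greater than $d$ is never spread.
\<close>

definition spread_seq :: "nat \<Rightarrow> nat list \<Rightarrow> nat list \<Rightarrow> bool" where
  "spread_seq n t js \<longleftrightarrow>
     sorted js \<and> set js \<subseteq> {1..n} \<and> length js \<le> length t + 1 \<and>
     (\<forall>i. Suc i < length js \<longrightarrow> int (js ! Suc i) - int (js ! i) \<ge> int (t ! i))"

definition spread_monomials :: "nat \<Rightarrow> nat \<Rightarrow> nat list \<Rightarrow> 'k::field mpoly set" where
  "spread_monomials n l t = {prod_list (map X js) | js. spread_seq n t js \<and> length js = l}"

definition is_spread :: "nat \<Rightarrow> nat list \<Rightarrow> 'k::field mpoly \<Rightarrow> bool" where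
  "is_spread n t u \<longleftrightarrow> (\<exists>l. u \<in> spread_monomials n l t)"

text \<open>The quotient $u/x_i$ is the (unique) \<open>w\<close> with \<open>u = X i * w\<close>.\<close>

definition spread_strongly_stable :: "nat \<Rightarrow> nat \<Rightarrow> nat list \<Rightarrow> 'k::field mpoly set \<Rightarrow> bool" where
  "spread_strongly_stable n l t L \<longleftrightarrow>
     L \<subseteq> spread_monomials n l t \<and>
     (\<forall>u\<in>L. \<forall>i\<in>{1..n}. \<forall>j\<in>{1..<i}. \<forall>w.
        u = X i * w \<and> is_spread n t (X j * w) \<longrightarrow> X j * w \<in> L)"

text \<open>
  The library order on \<open>nat \<Rightarrow>\<^sub>0 nat\<close> is lexicographic: \<open>b < a\<close> iff \<open>b\<close> has the smaller entry
  at the least index where \<open>a\<close> and \<open>b\<close> differ. On exponent vectors this is the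
  lexicographic order induced by $x_1 > x_2 > \dots$.
\<close>

definition lex_ge :: "'k::field mpoly \<Rightarrow> 'k mpoly \<Rightarrow> bool" where
  "lex_ge v u \<longleftrightarrow> (\<exists>a b. v = monom a \<and> u = monom b \<and> b \<le> a)"

definition spread_lex_set :: "nat \<Rightarrow> nat \<Rightarrow> nat list \<Rightarrow> 'k::field mpoly set \<Rightarrow> bool" where
  "spread_lex_set n l t L \<longleftrightarrow>
     L \<subseteq> spread_monomials n l t \<and>
     (\<forall>u\<in>L. \<forall>v\<in>spread_monomials n l t. lex_ge v u \<longrightarrow> v \<in> L)"

definition max_var :: "'k::field mpoly \<Rightarrow> nat" where
  "max_var u = Max {i. X i dvd u}"

definition m_eq :: "nat \<Rightarrow> 'k::field mpoly set \<Rightarrow> nat" where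
  "m_eq i L = card {u \<in> L. max_var u = i}"

definition m_le :: "nat \<Rightarrow> 'k::field mpoly set \<Rightarrow> nat" where
  "m_le j L = (\<Sum>i=1..j. m_eq i L)"

end

theory Submission
  imports Defs
begin

text \<open>
  A spread monomial is identified with its sorted sequence of indices, and the sequences of length \<open>l + 1\<close>
  ending in \<open>i\<close> are the \<open>w @ [i]\<close> with \<open>w\<close> spread of length \<open>l\<close> in the first \<open>i - t\<^sub>l\<close> variables.
  By induction on \<open>n\<close> it suffices to show that \<open>L\<close> has at most as many elements as \<open>N\<close> avoiding
  \<open>x\<^sub>n\<close>. Split \<open>N\<close> into its part \<open>N\<^sub>0\<close> avoiding \<open>x\<^sub>n\<close> and the set \<open>N\<^sub>1\<close> of the \<open>w\<close> with
  \<open>w @ [n] \<in> N\<close>, and replace both by lex sets \<open>C\<^sub>0\<close>, \<open>C\<^sub>1\<close> of the same sizes. The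
  induction hypothesis in one degree less, summed over the admissible last entries, shows that
  appending entries below \<open>n\<close> to \<open>C\<^sub>1\<close> yields a set no larger than \<open>C\<^sub>0\<close>, hence contained
  in it. If some \<open>u \<in> L\<close> avoided \<open>x\<^sub>n\<close> without being in \<open>C\<^sub>0\<close>, all of \<open>C\<^sub>0\<close> and all
  \<open>w @ [n]\<close> with \<open>w \<in> C\<^sub>1\<close> would be lex-larger than \<open>u\<close>, forcing \<open>|L| > |N|\<close>.
\<close>

section \<open>Spread sequences\<close>

definition spread_seqs :: "nat list \<Rightarrow> nat \<Rightarrow> nat \<Rightarrow> nat list set" where
  "spread_seqs t n l = {js. spread_seq n t js \<and> length js = l}"

text \<open>For \<open>w = []\<close> the index \<open>length w - 1\<close> is junk, harmlessly: \<open>[]\<close> is spread for every bound.\<close>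

lemma spread_seq_snoc:
  "spread_seq n t (w @ [i]) \<longleftrightarrow>
     length w \<le> length t \<and> 1 \<le> i \<and> i \<le> n \<and> spread_seq (i - t ! (length w - 1)) t w"
proof (cases w rule: rev_cases)
  case Nil
  then show ?thesis by (auto simp: spread_seq_def)
next
  case (snoc v j)
  have "(\<forall>k. Suc k < length (w @ [i]) \<longrightarrow> int ((w @ [i]) ! Suc k) - int ((w @ [i]) ! k) \<ge> int (t ! k)) \<longleftrightarrow>
    (\<forall>k. Suc k < length w \<longrightarrow> int (w ! Suc k) - int (w ! k) \<ge> int (t ! k)) \<and>
      j + t ! (length w - 1) \<le> i"
    using snoc by (auto simp: nth_append less_Suc_eq)
  moreover have "sorted (w @ [i]) \<and> set (w @ [i]) \<subseteq> {1..n} \<longleftrightarrow>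
      sorted w \<and> set w \<subseteq> {1..i - t ! (length w - 1)} \<and> 1 \<le> i \<and> i \<le> n"
    if "j + t ! (length w - 1) \<le> i"
    using that snoc by (fastforce simp: sorted_append)
  \<comment> \<open>Since \<open>1 \<le> j\<close>, the interval is nonempty, so the subtraction in
    its upper end is not truncated.\<close>
  moreover have "j + t ! (length w - 1) \<le> i" if "set w \<subseteq> {1..i - t ! (length w - 1)}"
    using that snoc by auto
  ultimately show ?thesis
    unfolding spread_seq_def by auto
qed

lemma snoc_in_spread_seqs:
  "w @ [i] \<in> spread_seqs t n (Suc l) \<longleftrightarrow>
     l \<le> length t \<and> 1 \<le> i \<and> i \<le> n \<and> w \<in> spread_seqs t (i - t ! (l - 1)) l"
  by (auto simp: spread_seqs_def spread_seq_snoc)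

lemma spread_seqs_mono: "m \<le> n \<Longrightarrow> spread_seqs t m l \<subseteq> spread_seqs t n l"
  by (fastforce simp: spread_seqs_def spread_seq_def)

lemma finite_spread_seqs: "finite (spread_seqs t n l)"
  by (rule finite_subset[OF _ finite_lists_length_eq[of "{1..n}" l]])
    (auto simp: spread_seqs_def spread_seq_def)

lemma length_spread_seqs: "js \<in> spread_seqs t n l \<Longrightarrow> length js = l"
  by (simp add: spread_seqs_def)

lemma length_spread_seqs_ball: "\<forall>js\<in>spread_seqs t n l. length js = l"
  by (simp add: spread_seqs_def)

lemma spread_seqs_SucE:
  assumes "u \<in> spread_seqs t n (Suc l)"
  obtains w i where "u = w @ [i]" "1 \<le> i" "i \<le> n" "w \<in> spread_seqs t (i - t ! (l - 1)) l"
  using assms by (cases u rule: rev_cases) (auto simp: snoc_in_spread_seqs dest: length_spread_seqs)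


section \<open>Initial segments and stable sets of sequences\<close>

text \<open>On sorted sequences of one length a smaller sequence means a lex-larger monomial, so
  these are the lex sets read as initial segments.\<close>

definition lex_initial :: "nat list set \<Rightarrow> nat list set \<Rightarrow> bool" where
  "lex_initial M A \<longleftrightarrow> A \<subseteq> M \<and> (\<forall>x\<in>A. \<forall>y\<in>M. (y, x) \<in> lex less_than \<longrightarrow> y \<in> A)"

lemma lex_initialD:
  "lex_initial M A \<Longrightarrow> x \<in> A \<Longrightarrow> y \<in> M \<Longrightarrow> (y, x) \<in> lex less_than \<Longrightarrow> y \<in> A"
  by (auto simp: lex_initial_def)

lemma lex_less_than_linear:
  "length x = length (y :: nat list) \<Longrightarrow> x = y \<or> (x, y) \<in> lex less_than \<or> (y, x) \<in> lex less_than"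
  by (induction x y rule: list_induct2) auto

lemma lex_initial_before:
  assumes "lex_initial M A" "x \<in> A" "u \<in> M" "u \<notin> A" "length x = length u"
  shows "(x, u) \<in> lex less_than"
  using lex_less_than_linear[OF assms(5)] lex_initialD[OF assms(1-3)] assms(2,4) by blast

lemma lex_snoc:
  "length v = length w \<Longrightarrow>
   (v @ [i], w @ [j]) \<in> lex less_than \<longleftrightarrow> (v, w) \<in> lex less_than \<or> v = w \<and> i < j"
  by (induction v w rule: list_induct2) auto

text \<open>The order is well-founded, so an initial segment smaller than \<open>M\<close> grows by
  the least element not yet in it.\<close>

lemma lex_initial_exists:
  assumes "c \<le> card M" "finite M" "\<forall>x\<in>M. length x = l"
  shows "\<exists>A. lex_initial M A \<and> card A = c"
  using assms(1)
proof (induction c)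
  case 0
  show ?case by (rule exI[of _ "{}"]) (simp add: lex_initial_def)
next
  case (Suc c)
  then obtain A where A: "lex_initial M A" "card A = c" by auto
  then have "A \<subseteq> M" "A \<noteq> M" using Suc.prems by (auto simp: lex_initial_def)
  then obtain q where "q \<in> M - A" by blast
  then obtain x where x: "x \<in> M - A" "\<And>y. (y, x) \<in> lex less_than \<Longrightarrow> y \<notin> M - A"
    by (rule wfE_min[OF wf_lex[OF wf_less_than]]) blast
  have "lex_initial M (insert x A)"
    using A(1) x by (auto simp: lex_initial_def)
  moreover have "card (insert x A) = Suc c"
    using A x \<open>A \<subseteq> M\<close> assms(2) finite_subset by fastforce
  ultimately show ?case by blast
qed

text \<open>Initial segments of a linear order are nested: an element of \<open>A\<close> outside
  \<open>B\<close> comes after all of \<open>B\<close>, which makes \<open>B\<close> a proper subset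
  of \<open>A\<close>.\<close>

lemma lex_initial_subset:
  assumes "lex_initial M A" "lex_initial M B" "card A \<le> card B"
    and "finite M" "\<forall>x\<in>M. length x = l"
  shows "A \<subseteq> B"
proof (rule ccontr)
  assume "\<not> A \<subseteq> B"
  then obtain x where x: "x \<in> A" "x \<notin> B" by blast
  have AM: "A \<subseteq> M" "B \<subseteq> M" using assms by (auto simp: lex_initial_def)
  have "B \<subseteq> A"
  proof
    fix y assume y: "y \<in> B"
    have len: "length y = length x" using x(1) y AM assms(5) by (metis subsetD)
    have "(y, x) \<in> lex less_than"
      using x AM by (intro lex_initial_before[OF assms(2) y _ _ len]) auto
    then show "y \<in> A"
      using y AM by (intro lex_initialD[OF assms(1) x(1)]) auto
  qed
  then have "B \<subset> A" using x by blast
  then show False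
    using psubset_card_mono[of A B] assms(3,4) AM finite_subset by fastforce
qed

text \<open>Entries are replaced in place, so for spread sequences only exchanges that leave the
  list sorted are demanded. This follows from stability of monomials and suffices for the
  induction.\<close>

definition seq_stable :: "nat list set \<Rightarrow> nat list set \<Rightarrow> bool" where
  "seq_stable M N \<longleftrightarrow> N \<subseteq> M \<and>
     (\<forall>js\<in>N. \<forall>p<length js. \<forall>a<js ! p. js[p := a] \<in> M \<longrightarrow> js[p := a] \<in> N)"

lemma seq_stableD:
  "seq_stable M N \<Longrightarrow> js \<in> N \<Longrightarrow> p < length js \<Longrightarrow> a < js ! p \<Longrightarrow> js[p := a] \<in> M \<Longrightarrow> js[p := a] \<in> N"
  by (auto simp: seq_stable_def)

lemma seq_stable_Int: "seq_stable M N \<Longrightarrow> M' \<subseteq> M \<Longrightarrow> seq_stable M' (N \<inter> M')"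
  by (auto simp: seq_stable_def)

lemma lex_initial_Int: "lex_initial M L \<Longrightarrow> M' \<subseteq> M \<Longrightarrow> lex_initial M' (L \<inter> M')"
  by (auto simp: lex_initial_def)

text \<open>Exchanges in \<open>w\<close> are exchanges in \<open>w @ [n]\<close> that keep the last
  entry. This makes the hypothesis in lower degree applicable to the residue.\<close>

lemma seq_stable_residue:
  assumes "seq_stable (spread_seqs t n (Suc l)) N"
  shows "seq_stable (spread_seqs t (n - t ! (l - 1)) l) {w. w @ [n] \<in> N}"
  unfolding seq_stable_def
proof (intro conjI ballI allI impI subsetI)
  fix w assume "w \<in> {w. w @ [n] \<in> N}"
  then have wN: "w @ [n] \<in> N" and w: "w @ [n] \<in> spread_seqs t n (Suc l)"
    using assms by (auto simp: seq_stable_def)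
  then show "w \<in> spread_seqs t (n - t ! (l - 1)) l"
    by (simp add: snoc_in_spread_seqs)
  fix p a
  assume p: "p < length w" "a < w ! p" "w[p := a] \<in> spread_seqs t (n - t ! (l - 1)) l"
  have "(w @ [n])[p := a] \<in> N"
    using p w
    by (intro seq_stableD[OF assms wN])
      (auto simp: nth_append list_update_append snoc_in_spread_seqs)
  then show "w[p := a] \<in> {w. w @ [n] \<in> N}"
    using p by (simp add: list_update_append)
qed

section \<open>Splitting off the last variable\<close>

lemma card_snoc_decomposition:
  assumes "N \<subseteq> spread_seqs t (Suc n) (Suc l)"
  shows "card N = card (N \<inter> spread_seqs t n (Suc l)) + card {w. w @ [Suc n] \<in> N}"
proof -
  let ?Nres = "{w. w @ [Suc n] \<in> N}"
  have fin: "finite N" using assms finite_spread_seqs finite_subset by blast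
  have "u \<in> (N \<inter> spread_seqs t n (Suc l)) \<union> (\<lambda>w. w @ [Suc n]) ` ?Nres" if u: "u \<in> N" for u
  proof -
    from u assms have "u \<in> spread_seqs t (Suc n) (Suc l)" by blast
    then show ?thesis
      using u by (cases rule: spread_seqs_SucE, cases u rule: rev_cases)
        (auto simp: snoc_in_spread_seqs le_Suc_eq)
  qed
  then have eq: "N = (N \<inter> spread_seqs t n (Suc l)) \<union> (\<lambda>w. w @ [Suc n]) ` ?Nres"
    by blast
  have "(N \<inter> spread_seqs t n (Suc l)) \<inter> (\<lambda>w. w @ [Suc n]) ` ?Nres = {}"
    by (auto simp: snoc_in_spread_seqs)
  moreover have "finite ((\<lambda>w. w @ [Suc n]) ` ?Nres)"
    using fin by (rule rev_finite_subset) auto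
  moreover have "card ((\<lambda>w. w @ [Suc n]) ` ?Nres) = card ?Nres"
    by (rule card_image) (simp add: inj_on_def)
  ultimately show ?thesis
    using fin by (subst eq) (subst card_Un_disjoint, auto)
qed

text \<open>The part of the shadow obtained by multiplying with a new last variable; the
  intersection selects the \<open>w\<close> for which appending \<open>i\<close> keeps the required
  gap.\<close>

definition seq_shadow :: "nat list \<Rightarrow> nat \<Rightarrow> nat \<Rightarrow> nat list set \<Rightarrow> nat list set" where
  "seq_shadow t n l A = (\<Union>i\<in>{1..n}. (\<lambda>w. w @ [i]) ` (A \<inter> spread_seqs t (i - t ! (l - 1)) l))"

text \<open>Images for different last entries are disjoint. The summands are exactly the counts that
  the hypothesis in lower degree compares.\<close>

lemma card_seq_shadow:
  "card (seq_shadow t n l A) = (\<Sum>i=1..n. card (A \<inter> spread_seqs t (i - t ! (l - 1)) l))"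
proof -
  have "card (seq_shadow t n l A) =
      (\<Sum>i=1..n. card ((\<lambda>w. w @ [i]) ` (A \<inter> spread_seqs t (i - t ! (l - 1)) l)))"
    unfolding seq_shadow_def
    by (rule card_UN_disjoint) (auto simp: finite_spread_seqs)
  also have "\<dots> = (\<Sum>i=1..n. card (A \<inter> spread_seqs t (i - t ! (l - 1)) l))"
    by (intro sum.cong refl card_image) (simp add: inj_on_def)
  finally show ?thesis .
qed

text \<open>A sequence before \<open>w @ [i]\<close> has an initial part before or equal to
  \<open>w\<close>, hence in \<open>A\<close>; the bound on \<open>m\<close> puts that part into the
  ambient set.\<close>

lemma lex_initial_seq_shadow:
  assumes A: "lex_initial (spread_seqs t m l) A" and "l \<le> length t" and m: "n - t ! (l - 1) \<le> m"
  shows "lex_initial (spread_seqs t n (Suc l)) (seq_shadow t n l A)"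
  unfolding lex_initial_def
proof (intro conjI ballI impI subsetI)
  fix x assume x: "x \<in> seq_shadow t n l A"
  then show "x \<in> spread_seqs t n (Suc l)"
    using assms(2) by (auto simp: seq_shadow_def snoc_in_spread_seqs)
  fix y assume "y \<in> spread_seqs t n (Suc l)" and yx: "(y, x) \<in> lex less_than"
  then obtain v j where y: "y = v @ [j]" "1 \<le> j" "j \<le> n" "v \<in> spread_seqs t (j - t ! (l - 1)) l"
    by (elim spread_seqs_SucE)
  from x obtain w i where w: "x = w @ [i]" "w \<in> A" "w \<in> spread_seqs t (i - t ! (l - 1)) l"
    by (auto simp: seq_shadow_def)
  have "j - t ! (l - 1) \<le> m" using y(3) m by linarith
  then have "v \<in> spread_seqs t m l" using y(4) spread_seqs_mono by blast
  moreover have "(v, w) \<in> lex less_than \<or> v = w"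
    using yx y w lex_snoc[of v w j i] length_spread_seqs by metis
  ultimately have "v \<in> A" using lex_initialD[OF A w(2)] w(2) by blast
  then show "y \<in> seq_shadow t n l A"
    using y by (auto simp: seq_shadow_def)
qed

text \<open>Lowering the last entry from \<open>Suc n\<close> to \<open>i\<close> is an exchange
  that stability permits.\<close>

lemma seq_shadow_residue_subset:
  assumes N: "seq_stable (spread_seqs t (Suc n) (Suc l)) N" and "l \<le> length t"
  shows "seq_shadow t n l {w. w @ [Suc n] \<in> N} \<subseteq> N \<inter> spread_seqs t n (Suc l)"
proof
  fix u assume "u \<in> seq_shadow t n l {w. w @ [Suc n] \<in> N}"
  then obtain w i where u: "u = w @ [i]" "1 \<le> i" "i \<le> n" "w @ [Suc n] \<in> N"
    "w \<in> spread_seqs t (i - t ! (l - 1)) l" by (auto simp: seq_shadow_def)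
  then have "(w @ [Suc n])[length w := i] \<in> N"
    using assms(2) by (intro seq_stableD[OF N]) (auto simp: snoc_in_spread_seqs)
  then show "u \<in> N \<inter> spread_seqs t n (Suc l)"
    using u assms(2) by (auto simp: snoc_in_spread_seqs)
qed

section \<open>Comparison of lex and stable sets by double induction\<close>

lemma card_avoiding_last_variable_le:
  assumes L: "lex_initial (spread_seqs t (Suc n) (Suc l)) L"
    and N: "seq_stable (spread_seqs t (Suc n) (Suc l)) N"
    and card: "card L \<le> card N" and l: "l \<le> length t"
    and IH: "\<And>m A B i. lex_initial (spread_seqs t m l) A \<Longrightarrow> seq_stable (spread_seqs t m l) B \<Longrightarrow>
      card A \<le> card B \<Longrightarrow> card (A \<inter> spread_seqs t i l) \<le> card (B \<inter> spread_seqs t i l)"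
  shows "card (L \<inter> spread_seqs t n (Suc l)) \<le> card (N \<inter> spread_seqs t n (Suc l))"
proof (rule ccontr)
  let ?Mfull = "spread_seqs t (Suc n) (Suc l)" and ?Mlow = "spread_seqs t n (Suc l)"
  define g where "g = t ! (l - 1)"
  let ?Mres = "spread_seqs t (Suc n - g) l"
  let ?Nlow = "N \<inter> ?Mlow"
  define N1 where "N1 = {w. w @ [Suc n] \<in> N}"
  assume "\<not> ?thesis"
  then have less: "card ?Nlow < card (L \<inter> ?Mlow)" by simp
  have N1: "seq_stable ?Mres N1"
    using seq_stable_residue[OF N] by (simp add: N1_def g_def)
  have M0: "?Mlow \<subseteq> ?Mfull" by (rule spread_seqs_mono) simp
  have "card ?Nlow \<le> card ?Mlow"
    by (simp add: card_mono finite_spread_seqs)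
  then obtain C0 where C0: "lex_initial ?Mlow C0" "card C0 = card ?Nlow"
    using lex_initial_exists[OF _ finite_spread_seqs length_spread_seqs_ball] by blast
  have "card N1 \<le> card ?Mres"
    using N1 by (simp add: seq_stable_def card_mono finite_spread_seqs)
  then obtain C1 where C1: "lex_initial ?Mres C1" "card C1 = card N1"
    using lex_initial_exists[OF _ finite_spread_seqs length_spread_seqs_ball] by blast
  have sub: "C0 \<subseteq> ?Mlow" "C1 \<subseteq> ?Mres" using C0 C1 by (auto simp: lex_initial_def)
  then have fin: "finite C0" "finite C1"
    by (auto intro: finite_subset[OF _ finite_spread_seqs])
  \<comment> \<open>\<open>IH\<close> is applied to each last entry \<open>i\<close>, with the bound
    \<open>i - t ! (l - 1)\<close>.\<close>
  have "card (seq_shadow t n l C1) \<le> card (seq_shadow t n l N1)"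
    unfolding card_seq_shadow using IH[OF C1(1) N1] C1(2) by (intro sum_mono) simp
  also have "\<dots> \<le> card ?Nlow"
    using seq_shadow_residue_subset[OF N l] finite_spread_seqs
    by (intro card_mono) (auto simp: N1_def)
  finally have "card (seq_shadow t n l C1) \<le> card C0" using C0 by simp
  moreover have "lex_initial ?Mlow (seq_shadow t n l C1)"
    using C1(1) l by (rule lex_initial_seq_shadow) (simp add: g_def)
  ultimately have shadow: "seq_shadow t n l C1 \<subseteq> C0"
    by (intro lex_initial_subset[OF _ C0(1) _ finite_spread_seqs length_spread_seqs_ball])
  have "\<not> L \<inter> ?Mlow \<subseteq> C0" 
    using less C0(2) card_mono[OF fin(1), of "L \<inter> ?Mlow"] by linarith
  then obtain u where u: "u \<in> L" "u \<in> ?Mlow" "u \<notin> C0" by blast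
  obtain v i where v: "u = v @ [i]" "1 \<le> i" "i \<le> n" "v \<in> spread_seqs t (i - g) l"
    unfolding g_def by (rule spread_seqs_SucE[OF u(2)])
  have "C0 \<subseteq> L"
  proof
    fix x assume x: "x \<in> C0"
    then have "length x = length u"
      using u(2) sub(1) by (auto simp: length_spread_seqs)
    then have "(x, u) \<in> lex less_than"
      by (rule lex_initial_before[OF C0(1) x u(2,3)])
    moreover have "x \<in> ?Mfull" using x sub(1) M0 by blast
    ultimately show "x \<in> L" by (intro lex_initialD[OF L u(1)])
  qed
  moreover have "w @ [Suc n] \<in> L" if w: "w \<in> C1" for w
  proof -
    have wM: "w \<in> ?Mres" using w sub by blast
    have "i - g \<le> Suc n - g" using v(3) by simp
    then have vM: "v \<in> ?Mres" using v(4) spread_seqs_mono by blast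
    \<comment> \<open>Otherwise \<open>u = v @ [i]\<close> would lie in the shadow of
      \<open>C1\<close>, hence in \<open>C0\<close>.\<close>
    have "v \<notin> C1"
      using shadow u(3) v unfolding seq_shadow_def g_def by fastforce
    then have "(w, v) \<in> lex less_than"
      using w wM vM by (intro lex_initial_before[OF C1(1)]) (simp_all add: length_spread_seqs)
    moreover have "length w = length v" using wM vM by (simp add: length_spread_seqs)
    ultimately have "(w @ [Suc n], u) \<in> lex less_than"
      using v(1) by (simp add: lex_snoc)
    moreover have "w @ [Suc n] \<in> ?Mfull"
      using wM l by (simp add: snoc_in_spread_seqs g_def)
    ultimately show ?thesis by (intro lex_initialD[OF L u(1)])
  qed
  ultimately have "insert u C0 \<subseteq> L \<inter> ?Mlow" "C1 \<subseteq> {w. w @ [Suc n] \<in> L}"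
    using u sub by auto
  moreover have Lsub: "L \<subseteq> ?Mfull" using L by (simp add: lex_initial_def)
  moreover have "finite {w. w @ [Suc n] \<in> L}"
    using finite_spread_seqs[of t "Suc n - g" l] by (rule rev_finite_subset)
      (use Lsub in \<open>auto simp: snoc_in_spread_seqs g_def\<close>)
  \<comment> \<open>The element \<open>u\<close> is the surplus: \<open>C0\<close> and
    \<open>C1\<close> alone already account for \<open>card N\<close>.\<close>
  ultimately have "card (insert u C0) + card C1 \<le> card L"
    unfolding card_snoc_decomposition[OF Lsub]
    by (intro add_mono card_mono) (auto simp: finite_spread_seqs)
  moreover have "card N = card C0 + card C1"
    using card_snoc_decomposition[of N t n l] N C0 C1 by (simp add: seq_stable_def N1_def)
  ultimately show False using card u fin by simp
qed

text \<open>Outer induction on the degree, inner one on the number of variables. The count for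
  arbitrary \<open>i\<close> is part of the claim because the shadow estimate needs many bounds at
  once.\<close>

lemma card_lex_initial_le_card_stable:
  assumes "lex_initial (spread_seqs t n l) L" "seq_stable (spread_seqs t n l) N" "card L \<le> card N"
  shows "card (L \<inter> spread_seqs t i l) \<le> card (N \<inter> spread_seqs t i l)"
  using assms
proof (induction l arbitrary: n L N i)
  case 0
  have "spread_seqs t m 0 = {[]}" for m by (auto simp: spread_seqs_def spread_seq_def)
  with 0 show ?case by (auto simp: lex_initial_def seq_stable_def Int_absorb2)
next
  case (Suc l)
  note degree_IH = Suc.IH
  show ?case
    using Suc.prems
  proof (induction n arbitrary: L N)
    case 0
    have "spread_seqs t 0 (Suc l) = {}" by (auto simp: spread_seqs_def spread_seq_def)
    with 0 show ?case by (simp add: lex_initial_def)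
  next
    case (Suc n)
    have sub: "L \<subseteq> spread_seqs t (Suc n) (Suc l)" "N \<subseteq> spread_seqs t (Suc n) (Suc l)"
      using Suc.prems by (auto simp: lex_initial_def seq_stable_def)
    have M0: "spread_seqs t n (Suc l) \<subseteq> spread_seqs t (Suc n) (Suc l)"
      by (rule spread_seqs_mono) simp
    consider "\<not> l \<le> length t" | "l \<le> length t" "Suc n \<le> i" | "l \<le> length t" "i \<le> n" by linarith
    then show ?case
    proof cases
      \<comment> \<open>The degree \<open>Suc l\<close> exceeds \<open>length t + 1\<close>, so
        there are no spread sequences.\<close>
      case 1
      then have "L = {}"
        using sub by (auto simp: spread_seqs_def spread_seq_def)
      then show ?thesis by simp
    next
      case 2
      then have "L \<inter> spread_seqs t i (Suc l) = L" "N \<inter> spread_seqs t i (Suc l) = N"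
        using sub spread_seqs_mono[of "Suc n" i t "Suc l"] by auto
      then show ?thesis using Suc.prems by simp
    next
      case 3
      \<comment> \<open>This restores the cardinality hypothesis after restriction to the first
        \<open>n\<close> variables, where the inner induction hypothesis applies.\<close>
      have "card (L \<inter> spread_seqs t n (Suc l)) \<le> card (N \<inter> spread_seqs t n (Suc l))"
        using card_avoiding_last_variable_le[OF Suc.prems 3(1)] degree_IH by blast
      then have "card (L \<inter> spread_seqs t n (Suc l) \<inter> spread_seqs t i (Suc l)) \<le>
          card (N \<inter> spread_seqs t n (Suc l) \<inter> spread_seqs t i (Suc l))"
        by (intro Suc.IH lex_initial_Int[OF _ M0] seq_stable_Int[OF _ M0] Suc.prems)
      then show ?thesis
        using spread_seqs_mono[OF 3(2), of t "Suc l"] by (simp add: Int_assoc Int_absorb1)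
    qed
  qed
qed


section \<open>Monomials as sequences of indices\<close>

definition exponents :: "nat list \<Rightarrow> nat \<Rightarrow>\<^sub>0 nat" where
  "exponents js = (\<Sum>j\<leftarrow>js. Poly_Mapping.single j 1)"

lemma lookup_exponents: "Poly_Mapping.lookup (exponents js) k = count_list js k"
  by (induction js) (auto simp: exponents_def lookup_add lookup_single when_def)

lemma prod_list_X: "prod_list (map X js) = monom (exponents js)"
  by (induction js) (simp_all add: exponents_def X_def monom_def mult_single)

lemma monom_inject: "monom a = (monom b :: 'k::field mpoly) \<longleftrightarrow> a = b"
proof
  assume "monom a = (monom b :: 'k mpoly)"
  then have "Poly_Mapping.keys (monom a :: 'k mpoly) = Poly_Mapping.keys (monom b :: 'k mpoly)" by simp
  then show "a = b" by (simp add: monom_def)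
qed simp

text \<open>At the first difference \<open>x < y\<close>, sortedness keeps \<open>x\<close> out of
  the rest of \<open>ys\<close> and everything below \<open>x\<close> out of both tails. So the
  exponents first differ at \<open>x\<close>.\<close>

lemma exponents_lex:
  assumes "sorted xs" "sorted ys" "(xs, ys) \<in> lex less_than"
  shows "exponents ys < exponents xs"
proof -
  from assms(3) obtain p x y xs' ys' where *: "xs = p @ x # xs'" "ys = p @ y # ys'" "x < y"
    by (auto simp: lex_conv)
  have "count_list ys x < count_list xs x"
  proof -
    have "x \<notin> set ys'" using * assms(2) by (auto simp: sorted_append)
    then show ?thesis using * by simp
  qed
  moreover have "count_list ys k = count_list xs k" if "k < x" for k
  proof -
    have "k \<notin> set xs'" "k \<notin> set ys'" using * assms that by (auto simp: sorted_append)
    then show ?thesis using * that by simp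
  qed
  ultimately show ?thesis
    by (auto simp: less_poly_mapping.rep_eq less_fun_def lookup_exponents)
qed

text \<open>Distinct sequences of equal length are lex comparable, and then their exponent vectors
  differ strictly.\<close>

lemma inj_on_prod_list_X: "inj_on (\<lambda>js. prod_list (map X js) :: 'k::field mpoly) (spread_seqs t n l)"
proof (rule inj_onI)
  fix x y
  assume xy: "x \<in> spread_seqs t n l" "y \<in> spread_seqs t n l"
    and "prod_list (map X x) = (prod_list (map X y) :: 'k mpoly)"
  then have eq: "exponents x = exponents y" by (simp add: prod_list_X monom_inject)
  have "sorted x" "sorted y" "length x = length y"
    using xy by (auto simp: spread_seqs_def spread_seq_def)
  then show "x = y"
    using lex_less_than_linear[of x y] exponents_lex[of x y] exponents_lex[of y x] eq by auto
qed

lemma X_dvd_prod_list_X: "X i dvd (prod_list (map X js) :: 'k::field mpoly) \<longleftrightarrow> i \<in> set js"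
proof
  assume "X i dvd (prod_list (map X js) :: 'k mpoly)"
  then obtain q :: "'k mpoly" where q: "monom (exponents js) = X i * q"
    unfolding prod_list_X by (elim dvdE)
  then have "exponents js \<in> Poly_Mapping.keys (X i * q)" by (simp add: monom_def flip: q)
  \<comment> \<open>Each exponent vector in a product is a sum of exponent vectors of the
    factors.\<close>
  then obtain b where "exponents js = Poly_Mapping.single i 1 + b"
    using keys_mult[of "X i" q] by (auto simp: X_def monom_def)
  then have "Poly_Mapping.lookup (exponents js) i > 0" by (simp add: lookup_add)
  then show "i \<in> set js" using count_list_0_iff[of js i] by (auto simp: lookup_exponents)
next
  assume "i \<in> set js"
  then show "X i dvd (prod_list (map X js) :: 'k mpoly)"
    by (auto dest!: split_list)
qed

lemma max_var_prod_list_X: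
  "max_var (prod_list (map X js) :: 'k::field mpoly) = Max (set js)"
  by (simp add: max_var_def X_dvd_prod_list_X)

lemma spread_monomials_eq:
  "spread_monomials n l t = (\<lambda>js. prod_list (map X js)) ` spread_seqs t n l"
  by (auto simp: spread_monomials_def spread_seqs_def)

section \<open>Transfer between sets of monomials and of sequences\<close>

definition index_seqs :: "nat list \<Rightarrow> nat \<Rightarrow> nat \<Rightarrow> 'k::field mpoly set \<Rightarrow> nat list set" where
  "index_seqs t n l A = {js \<in> spread_seqs t n l. prod_list (map X js) \<in> A}"

lemma image_index_seqs:
  "A \<subseteq> spread_monomials n l t \<Longrightarrow> (\<lambda>js. prod_list (map X js)) ` index_seqs t n l A = A"
  by (auto simp: index_seqs_def spread_monomials_eq)

lemma card_index_seqs: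
  assumes "A \<subseteq> spread_monomials n l t"
  shows "card (index_seqs t n l A) = card A"
proof -
  have "inj_on (\<lambda>js. prod_list (map X js) :: 'a mpoly) (index_seqs t n l A)"
    by (rule inj_on_subset[OF inj_on_prod_list_X]) (auto simp: index_seqs_def)
  from card_image[OF this] show ?thesis by (simp add: image_index_seqs[OF assms])
qed

text \<open>For a nonempty sequence the maximum is at most \<open>i\<close> exactly when all entries
  are, so the partial sums count sequences in the first \<open>i\<close> variables.\<close>

lemma m_le_eq_card:
  assumes A: "A \<subseteq> spread_monomials n l t" and "1 \<le> l" "i \<le> n"
  shows "m_le i A = card (index_seqs t n l A \<inter> spread_seqs t i l)"
proof -
  have fin: "finite A" using A by (rule finite_subset) (simp add: spread_monomials_eq finite_spread_seqs)
  have iff: "Max (set js) \<in> {1..i} \<longleftrightarrow> js \<in> spread_seqs t i l" if "js \<in> spread_seqs t n l" for js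
  proof -
    have js: "js \<noteq> []" "set js \<subseteq> {1..n}"
      using that \<open>1 \<le> l\<close> by (auto simp: spread_seqs_def spread_seq_def)
    then have "Max (set js) \<in> set js" by simp
    with js have "1 \<le> Max (set js)" by (meson atLeastAtMost_iff subsetD)
    then have "Max (set js) \<in> {1..i} \<longleftrightarrow> set js \<subseteq> {1..i}" using js by auto
    then show ?thesis using that by (auto simp: spread_seqs_def spread_seq_def)
  qed
  have "m_le i A = card (\<Union>k\<in>{1..i}. {u \<in> A. max_var u = k})"
    unfolding m_le_def m_eq_def using fin by (subst card_UN_disjoint) auto
  also have "(\<Union>k\<in>{1..i}. {u \<in> A. max_var u = k}) = {u \<in> A. max_var u \<in> {1..i}}" by auto
  also have "card \<dots> = card (index_seqs t n l {u \<in> A. max_var u \<in> {1..i}})"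
    using A by (subst card_index_seqs) auto
  also have "index_seqs t n l {u \<in> A. max_var u \<in> {1..i}} = index_seqs t n l A \<inter> spread_seqs t i l"
    using iff unfolding index_seqs_def by (auto simp: max_var_prod_list_X)
  finally show ?thesis .
qed

lemma lex_initial_index_seqs:
  assumes "spread_lex_set n l t (L :: 'k::field mpoly set)"
  shows "lex_initial (spread_seqs t n l) (index_seqs t n l L)"
  unfolding lex_initial_def
proof (intro conjI ballI impI)
  fix x y
  assume x: "x \<in> index_seqs t n l L" and y: "y \<in> spread_seqs t n l" and yx: "(y, x) \<in> lex less_than"
  have "sorted x" "sorted y" using x y by (auto simp: index_seqs_def spread_seqs_def spread_seq_def)
  then have "lex_ge (prod_list (map X y)) (prod_list (map X x) :: 'k mpoly)"
    using exponents_lex[OF _ _ yx] unfolding lex_ge_def prod_list_X by (blast intro: less_imp_le)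
  then show "y \<in> index_seqs t n l L"
    using assms x y by (auto simp: spread_lex_set_def index_seqs_def spread_monomials_eq)
qed (auto simp: index_seqs_def)

lemma seq_stable_index_seqs:
  assumes "spread_strongly_stable n l t (N :: 'k::field mpoly set)"
  shows "seq_stable (spread_seqs t n l) (index_seqs t n l N)"
  unfolding seq_stable_def
proof (intro conjI ballI allI impI)
  fix js p a
  assume js: "js \<in> index_seqs t n l N" and p: "p < length js" and a: "a < js ! p"
    and upd: "js[p := a] \<in> spread_seqs t n l"
  \<comment> \<open>The quotient by the variable at position \<open>p\<close>; writing
    \<open>a\<close> there gives \<open>X a * w\<close>.\<close>
  define w where "w = (prod_list (map X (take p js @ drop (Suc p) js)) :: 'k mpoly)"
  have "prod_list (map X js) = X (js ! p) * w"
    by (subst id_take_nth_drop[OF p]) (simp add: w_def mult.left_commute)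
  moreover have eq: "prod_list (map X (js[p := a])) = X a * w"
    by (simp add: upd_conv_take_nth_drop[OF p] w_def mult.left_commute)
  moreover have "is_spread n t (X a * w)"
    using upd by (auto simp: is_spread_def spread_monomials_eq simp flip: eq)
  moreover have "js ! p \<in> {1..n}"
    using js p nth_mem[OF p] unfolding index_seqs_def spread_seqs_def spread_seq_def by blast
  moreover have "a \<in> {1..<js ! p}"
    using upd a set_update_memI[OF p, of a] by (auto simp: spread_seqs_def spread_seq_def)
  moreover have "prod_list (map X js) \<in> N" using js by (simp add: index_seqs_def)
  ultimately have "prod_list (map X (js[p := a])) \<in> N"
    using assms unfolding spread_strongly_stable_def by metis
  then show "js[p := a] \<in> index_seqs t n l N" using upd by (simp add: index_seqs_def)
qed (auto simp: index_seqs_def)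

theorem theorem3p4:
  fixes n d l :: nat and t :: "nat list" and L N :: "'k::field mpoly set"
  assumes "d \<ge> 2" and "length t = d - 1" and "1 \<le> l" and "l \<le> d"
    and "spread_lex_set n l t L"
    and "spread_strongly_stable n l t N"
    and "card L \<le> card N"
  shows "\<forall>i\<in>{1..n}. m_le i L \<le> m_le i N"
proof
  fix i assume i: "i \<in> {1..n}"
  have sub: "L \<subseteq> spread_monomials n l t" "N \<subseteq> spread_monomials n l t"
    using assms(5,6) by (auto simp: spread_lex_set_def spread_strongly_stable_def)
  have "card (index_seqs t n l L \<inter> spread_seqs t i l) \<le> card (index_seqs t n l N \<inter> spread_seqs t i l)"
    using card_lex_initial_le_card_stable[OF lex_initial_index_seqs[OF assms(5)]
        seq_stable_index_seqs[OF assms(6)]] assms(7) by (simp add: card_index_seqs sub)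
  then show "m_le i L \<le> m_le i N"
    using i assms(3) by (simp add: m_le_eq_card[OF sub(1)] m_le_eq_card[OF sub(2)])
qed

end
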